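(* Let $D$ be the generator of a strongly continuous one-parameter group of isometries $e^{tD}$, $t\in\mathbb{R}$, in a complex Banach space $E$, and let $\sigma>0$. For every $r\in\mathbb{N}$, $r\geq 1$, and every $f\in\mathbf{B}_\sigma(D)$, $$D^rf=\mathcal{B}^{(r)}_D(\sigma)f,$$ where the series defining $\mathcal{B}_D^{(r)}(\sigma)$ converges in the norm of $E$; moreover, when $f$ is replaced by $e^{tD}f$, the convergence is uniform with respect to $t\in\mathbb{R}$.
   Context: $\mathcal{D}^\infty$ is the intersection of the domains of all powers $D^k$, $k\in\mathbb{N}$. $\mathbf{B}_\sigma(D)$ is the set of all $f\in\mathcal{D}^\infty$ such that $\|D^kf\|\le\sigma^k\|f\|$ for all $k\in\mathbb{N}=\{1,2,\dots\}$. $\mathrm{sinc}(x)=\frac{\sin\pi x}{\pi x}$ for $x\ne0$, $\mathrm{sinc}(0)=1$, and $\mathrm{sinc}^{(j)}$ is its $j$-th derivative. For $m\in\mathbb{N}$, $k\in\mathbb{Z}$ put $$A_{m,k}=(-1)^{k+1}\mathrm{sinc}^{(2m-1)}\big(\tfrac12-k\big),\qquad B_{m,k}=(-1)^{k+1}\mathrm{sinc}^{(2m)}(-k)$$ (in particular $B_{m,0}=(-1)^{m+1}\frac{\pi^{2m}}{2m+1}$). The operators $\mathcal{B}_D^{(r)}(\sigma)$ on $E$ are, for $m\in\mathbb{N}$, $$\mathcal{B}^{(2m-1)}_D(\sigma)f=\Big(\frac{\sigma}{\pi}\Big)^{2m-1}\sum_{k\in\mathbb{Z}}(-1)^{k+1}A_{m,k}\,e^{\frac{\pi}{\sigma}(k-1/2)D}f,$$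 $$\mathcal{B}^{(2m)}_D(\sigma)f=\Big(\frac{\sigma}{\pi}\Big)^{2m}\sum_{k\in\mathbb{Z}}(-1)^{k+1}B_{m,k}\,e^{\frac{\pi k}{\sigma}D}f .$$ *)

theory Defs
  imports "HOL-Analysis.Analysis"
begin

text \<open>The distribution has only real Banach spaces; a complex Banach space is a real one whose
  scalar multiplication extends to the complex numbers compatibly with the norm.\<close>

class complex_banach = banach +
  fixes scaleC :: "complex \<Rightarrow> 'a \<Rightarrow> 'a" (infixr \<open>*\<^sub>C\<close> 75)
  assumes scaleC_add_right: "a *\<^sub>C (x + y) = a *\<^sub>C x + a *\<^sub>C y"
    and scaleC_add_left: "(a + b) *\<^sub>C x = a *\<^sub>C x + b *\<^sub>C x"
    and scaleC_scaleC: "a *\<^sub>C b *\<^sub>C x = (a * b) *\<^sub>C x"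
    and scaleR_scaleC: "r *\<^sub>R x = complex_of_real r *\<^sub>C x"
    and norm_scaleC: "norm (a *\<^sub>C x) = cmod a * norm x"

locale isometry_group =
  fixes T :: "real \<Rightarrow> 'a::complex_banach \<Rightarrow> 'a"
  assumes clinear: "Vector_Spaces.linear (*\<^sub>C) (*\<^sub>C) (T t)"
    and zero: "T 0 = id"
    and add: "T (s + t) = T s \<circ> T t"
    and isometry: "norm (T t f) = norm f"
    and strongly_continuous: "continuous_on UNIV (\<lambda>t. T t f)"

text \<open>An unbounded operator is given by its domain \<open>S\<close> and a total function \<open>D\<close> whose values
  outside \<open>S\<close> are irrelevant. The group generated by \<open>D\<close>, i.e. \<open>t \<mapsto> exp (t D)\<close>, is \<open>T\<close>.\<close>

definition is_generator ::
    "'a set \<Rightarrow> ('a \<Rightarrow> 'a) \<Rightarrow> (real \<Rightarrow> 'a \<Rightarrow> 'a::complex_banach) \<Rightarrow> bool" where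
  "is_generator S D T \<longleftrightarrow>
     S = {f. \<exists>g. ((\<lambda>t. (T t f - f) /\<^sub>R t) \<longlongrightarrow> g) (at 0)} \<and>
     (\<forall>f\<in>S. ((\<lambda>t. (T t f - f) /\<^sub>R t) \<longlongrightarrow> D f) (at 0))"

primrec pow_domain :: "'a set \<Rightarrow> ('a \<Rightarrow> 'a) \<Rightarrow> nat \<Rightarrow> 'a set" where
  "pow_domain S D 0 = UNIV"
| "pow_domain S D (Suc k) = {f \<in> pow_domain S D k. (D ^^ k) f \<in> S}"

definition smooth_domain :: "'a set \<Rightarrow> ('a \<Rightarrow> 'a) \<Rightarrow> 'a set" where
  "smooth_domain S D = (\<Inter>k. pow_domain S D k)"

definition bernstein_space :: "'a set \<Rightarrow> ('a \<Rightarrow> 'a) \<Rightarrow> real \<Rightarrow> 'a::complex_banach set" where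
  "bernstein_space S D \<sigma> =
     {f \<in> smooth_domain S D. \<forall>k\<ge>1. norm ((D ^^ k) f) \<le> \<sigma> ^ k * norm f}"

text \<open>The normalised cardinal sine, not the \<open>sin x / x\<close> of \<open>HOL-Probability\<close>.\<close>

definition nsinc :: "real \<Rightarrow> real" where
  "nsinc x = (if x = 0 then 1 else sin (pi * x) / (pi * x))"

definition coeff_A :: "nat \<Rightarrow> int \<Rightarrow> real" where
  "coeff_A m k = (-1) powi (k + 1) * (deriv ^^ (2 * m - 1)) nsinc (1 / 2 - of_int k)"

definition coeff_B :: "nat \<Rightarrow> int \<Rightarrow> real" where
  "coeff_B m k = (-1) powi (k + 1) * (deriv ^^ (2 * m)) nsinc (- of_int k)"

text \<open>The order \<open>r \<ge> 1\<close> is \<open>2 m - 1\<close> or \<open>2 m\<close> for a unique \<open>m \<ge> 1\<close>.\<close>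

definition riesz_boas_term ::
    "(real \<Rightarrow> 'a \<Rightarrow> 'a::complex_banach) \<Rightarrow> real \<Rightarrow> nat \<Rightarrow> 'a \<Rightarrow> int \<Rightarrow> 'a" where
  "riesz_boas_term T \<sigma> r f k =
     (if odd r
      then ((-1) powi (k + 1) * coeff_A ((r + 1) div 2) k) *\<^sub>R T (pi / \<sigma> * (of_int k - 1 / 2)) f
      else ((-1) powi (k + 1) * coeff_B (r div 2) k) *\<^sub>R T (pi * of_int k / \<sigma>) f)"

definition riesz_boas_operator ::
    "(real \<Rightarrow> 'a \<Rightarrow> 'a::complex_banach) \<Rightarrow> real \<Rightarrow> nat \<Rightarrow> 'a \<Rightarrow> 'a" where
  "riesz_boas_operator T \<sigma> r f = (\<sigma> / pi) ^ r *\<^sub>R (\<Sum>\<^sub>\<infinity>k\<in>UNIV. riesz_boas_term T \<sigma> r f k)"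

end

theory Submission
  imports Defs "HOL-Complex_Analysis.Complex_Analysis"
begin

text \<open>A norming functional \<open>u\<close> reduces the formula to \<open>x \<mapsto> u (T x f)\<close>, which after rescaling extends
  to an entire function \<open>\<psi>\<close> with \<open>|\<psi> z| \<le> M exp (\<pi> |Im z|)\<close>. The remainder of its cardinal series,
  truncated to \<open>|k| \<le> N\<close>, vanishes at these \<open>k\<close>, hence equals \<open>sin (\<pi> z) g\<^sub>N(z)\<close>. On the boundary of
  the square of half-width \<open>N + 1/2\<close> one has \<open>g\<^sub>N = O(\<surd>N)\<close>, hence also inside by the maximum principle,
  so by Cauchy's inequality every derivative of positive order of \<open>g\<^sub>N\<close> at \<open>\<delta>\<close> tends to \<open>0\<close>. If the
  \<open>r\<close>-th derivative of \<open>sin (\<pi> z)\<close> vanishes at \<open>\<delta>\<close>, Leibniz' rule involves only these, and the series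
  may be differentiated \<open>r\<close> times term by term at \<open>\<delta>\<close>; this is the case for \<open>\<delta> = 1/2\<close> (\<open>r\<close> odd) and
  \<open>\<delta> = 0\<close> (\<open>r\<close> even). Uniformity in \<open>t\<close> is automatic since \<open>T t\<close> is an isometry commuting with
  \<open>D\<close> and the group.\<close>

subsection \<open>Norming functionals\<close>

text \<open>Homogeneity is required only as an inequality, which is easier to check for infima;
  \<open>sublinear_scale\<close> recovers equality.\<close>

definition sublinear :: "('a::real_vector \<Rightarrow> real) \<Rightarrow> bool" where
  "sublinear p \<longleftrightarrow> (\<forall>x y. p (x + y) \<le> p x + p y) \<and> (\<forall>c\<ge>0. \<forall>x. p (c *\<^sub>R x) \<le> c * p x)"

lemma sublinearI:
  assumes "\<And>x y. p (x + y) \<le> p x + p y" "\<And>c x. c \<ge> 0 \<Longrightarrow> p (c *\<^sub>R x) \<le> c * p x"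
  shows "sublinear p"
  using assms by (auto simp: sublinear_def)

lemma sublinear_add: "sublinear p \<Longrightarrow> p (x + y) \<le> p x + p y"
  by (auto simp: sublinear_def)

lemma sublinear_zero:
  assumes "sublinear p"
  shows "p 0 = 0"
proof -
  have "p (0 *\<^sub>R 0) \<le> 0 * p 0"
    using assms unfolding sublinear_def by blast
  moreover have "p (0 + 0) \<le> p 0 + p 0"
    using assms by (rule sublinear_add)
  ultimately show ?thesis by simp
qed

lemma sublinear_scale:
  assumes "sublinear p" "c \<ge> 0"
  shows "p (c *\<^sub>R x) = c * p x"
proof (cases "c = 0")
  case True
  then show ?thesis using sublinear_zero[OF assms(1)] by simp
next
  case False
  have "p ((1 / c) *\<^sub>R (c *\<^sub>R x)) \<le> 1 / c * p (c *\<^sub>R x)"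
    using assms unfolding sublinear_def by (meson zero_le_divide_1_iff)
  then have "c * p x \<le> p (c *\<^sub>R x)"
    using False assms(2) by (simp add: field_simps)
  moreover have "p (c *\<^sub>R x) \<le> c * p x"
    using assms unfolding sublinear_def by blast
  ultimately show ?thesis by simp
qed

lemma sublinear_ge: "sublinear p \<Longrightarrow> - p (- x) \<le> p x"
  using sublinear_add[of p x "- x"] sublinear_zero[of p] by simp

text \<open>Sliding along \<open>y\<close> and paying \<open>p y\<close> per unit keeps
  sublinearity, and subadditivity bounds the result below by \<open>- p (- x)\<close>. Used twice:
  to fix the value at the vector to be normed, and to show that a minimal functional is odd.\<close>

lemma sublinear_lower:
  assumes p: "sublinear p"
  obtains q where "sublinear q" "\<And>x. q x \<le> p x" "q (- y) \<le> - p y"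
proof -
  \<comment> \<open>the largest sublinear functional below \<open>p\<close> whose value at \<open>- y\<close> is at most \<open>- p y\<close>\<close>
  define q where "q = (\<lambda>x. INF t\<in>{0..}. p (x + t *\<^sub>R y) - t * p y)"
  have bdd: "bdd_below ((\<lambda>t. p (x + t *\<^sub>R y) - t * p y) ` {0..})" for x
  proof (rule bdd_belowI2)
    fix t :: real assume "t \<in> {0..}"
    then have "t * p y = p ((x + t *\<^sub>R y) + (- x))"
      using sublinear_scale[OF p, of t y] by simp
    also have "\<dots> \<le> p (x + t *\<^sub>R y) + p (- x)"
      by (rule sublinear_add[OF p])
    finally show "- p (- x) \<le> p (x + t *\<^sub>R y) - t * p y" by simp
  qed
  have le: "q x \<le> p (x + t *\<^sub>R y) - t * p y" if "t \<ge> 0" for t x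
    unfolding q_def using that by (intro cINF_lower bdd) auto
  have ge: "c \<le> q x" if "\<And>t. t \<ge> 0 \<Longrightarrow> c \<le> p (x + t *\<^sub>R y) - t * p y" for c x
    unfolding q_def using that by (intro cINF_greatest) auto
  show thesis
  proof
    show "q x \<le> p x" for x using le[of 0 x] by simp
    show "q (- y) \<le> - p y" using le[of 1 "- y"] sublinear_zero[OF p] by simp
    show "sublinear q"
    proof (rule sublinearI)
      fix x x'
      \<comment> \<open>Slides by \<open>t\<close> and \<open>s\<close> of the two summands combine
        to a slide by \<open>t + s\<close> of the sum; the two infima are then taken one after the
        other.\<close>
      have "q (x + x') - (p (x' + s *\<^sub>R y) - s * p y) \<le> q x" if s: "s \<ge> 0" for s
      proof (rule ge)
        fix t :: real assume t: "t \<ge> 0"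
        have "q (x + x') \<le> p ((x + x') + (t + s) *\<^sub>R y) - (t + s) * p y"
          using s t by (intro le) auto
        also have "(x + x') + (t + s) *\<^sub>R y = (x + t *\<^sub>R y) + (x' + s *\<^sub>R y)"
          by (simp add: algebra_simps)
        also have "p \<dots> \<le> p (x + t *\<^sub>R y) + p (x' + s *\<^sub>R y)"
          by (rule sublinear_add[OF p])
        finally show "q (x + x') - (p (x' + s *\<^sub>R y) - s * p y) \<le> p (x + t *\<^sub>R y) - t * p y"
          by (simp add: algebra_simps)
      qed
      then have "q (x + x') - q x \<le> q x'"
        by (intro ge) (simp add: algebra_simps)
      then show "q (x + x') \<le> q x + q x'" by simp
    next
      fix c :: real and x assume c: "c \<ge> 0"
      show "q (c *\<^sub>R x) \<le> c * q x"
      proof (cases "c = 0")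
        case True
        then show ?thesis using le[of 0 0] sublinear_zero[OF p] by simp
      next
        case False
        then have c: "c > 0" using c by simp
        have "q (c *\<^sub>R x) / c \<le> q x"
        proof (rule ge)
          fix t :: real assume t: "t \<ge> 0"
          have "q (c *\<^sub>R x) \<le> p (c *\<^sub>R x + (c * t) *\<^sub>R y) - (c * t) * p y"
            using c t by (intro le) auto
          also have "c *\<^sub>R x + (c * t) *\<^sub>R y = c *\<^sub>R (x + t *\<^sub>R y)"
            by (simp add: algebra_simps)
          also have "p \<dots> = c * p (x + t *\<^sub>R y)"
            using c by (intro sublinear_scale[OF p]) simp
          finally show "q (c *\<^sub>R x) / c \<le> p (x + t *\<^sub>R y) - t * p y"
            using c by (simp add: field_simps)
        qed
        then show ?thesis using c by (simp add: field_simps)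
      qed
    qed
  qed
qed

text \<open>Zorn's lemma for the reversed pointwise order. A chain is bounded below by its pointwise
  infimum, which is finite because \<open>- p (- x) \<le> q x\<close> for every sublinear
  \<open>q\<close> below \<open>p\<close>.\<close>

lemma ex_minimal_sublinear:
  assumes p: "sublinear p"
  obtains u where "sublinear u" "u \<le> p" "\<And>q. sublinear q \<Longrightarrow> q \<le> u \<Longrightarrow> q = u"
proof -
  define A where "A = {q. sublinear q \<and> q \<le> p}"
  have lb: "- p (- x) \<le> q x" if "q \<in> A" for q x
    using that sublinear_ge[of q x] by (force simp: A_def le_fun_def dest: spec[of _ "- x"])
  have "\<exists>m\<in>A. \<forall>q\<in>A. m \<ge> q \<longrightarrow> q = m"
  proof (rule predicate_Zorn)
    show "partial_order_on A (relation_of (\<ge>) A)"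
      by (rule partial_order_on_relation_ofI) auto
    fix C assume C: "C \<in> Chains (relation_of (\<ge>) A)"
    then have CA: "C \<subseteq> A" by (rule Chains_relation_of)
    have tot: "q \<le> q' \<or> q' \<le> q" if "q \<in> C" "q' \<in> C" for q q'
      using C that by (auto simp: Chains_def relation_of_def)
    show "\<exists>u\<in>A. \<forall>q\<in>C. q \<ge> u"
    proof (cases "C = {}")
      case True
      then show ?thesis using p by (auto simp: A_def)
    next
      case False
      define u where "u = (\<lambda>x. INF q\<in>C. q x)"
      have bdd: "bdd_below ((\<lambda>q. q x) ` C)" for x
        using lb CA by (intro bdd_belowI2[of _ "- p (- x)"]) auto
      have le: "u x \<le> q x" if "q \<in> C" for q x
        unfolding u_def using that by (intro cINF_lower bdd)
      have ge: "c \<le> u x" if "\<And>q. q \<in> C \<Longrightarrow> c \<le> q x" for c x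
        unfolding u_def using that False by (intro cINF_greatest) auto
      have sub: "sublinear q" if "q \<in> C" for q using that CA by (auto simp: A_def)
      have "sublinear u"
      proof (rule sublinearI)
        fix x y
        have "u (x + y) - q' y \<le> q x" if qq: "q \<in> C" "q' \<in> C" for q q'
        proof -
          \<comment> \<open>An infimum of sublinear functionals need not be subadditive; in a chain
            the smaller of \<open>q\<close> and \<open>q'\<close> serves for both summands.\<close>
          obtain q'' where q'': "q'' \<in> C" "q'' \<le> q" "q'' \<le> q'"
            using tot[OF qq] qq by blast
          have "u (x + y) \<le> q'' x + q'' y"
            using le[OF q''(1)] sublinear_add[OF sub[OF q''(1)]] order_trans by blast
          also have "\<dots> \<le> q x + q' y" using q'' by (intro add_mono) (auto simp: le_fun_def)
          finally show ?thesis by simp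
        qed
        then have "u (x + y) - q' y \<le> u x" if "q' \<in> C" for q'
          using that by (intro ge)
        then have "u (x + y) - u x \<le> u y"
          by (intro ge) (simp add: algebra_simps)
        then show "u (x + y) \<le> u x + u y" by simp
      next
        fix c :: real and x assume c: "c \<ge> 0"
        show "u (c *\<^sub>R x) \<le> c * u x"
        proof (cases "c = 0")
          case True
          obtain q where "q \<in> C" using \<open>C \<noteq> {}\<close> by blast
          with True show ?thesis using le[of q 0] sublinear_zero[OF sub, of q] by simp
        next
          case False
          then have c: "c > 0" using c by simp
          have "u (c *\<^sub>R x) / c \<le> u x"
          proof (rule ge)
            fix q assume q: "q \<in> C"
            have "u (c *\<^sub>R x) \<le> c * q x"
              using le[OF q, of "c *\<^sub>R x"] sublinear_scale[OF sub[OF q], of c x] c by simp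
            then show "u (c *\<^sub>R x) / c \<le> q x" using c by (simp add: field_simps)
          qed
          then show ?thesis using c by (simp add: field_simps)
        qed
      qed
      moreover obtain q where "q \<in> C" using False by blast
      then have "u \<le> p" using le CA by (force simp: A_def le_fun_def intro: order_trans)
      ultimately show ?thesis using le by (auto simp: A_def le_fun_def)
    qed
  qed
  then obtain u where u: "u \<in> A" "\<And>q. q \<in> A \<Longrightarrow> q \<le> u \<Longrightarrow> q = u" by blast
  then show thesis
    using that[of u] order_trans by (fastforce simp: A_def)
qed

text \<open>Hahn-Banach without extension steps: a minimal sublinear functional is odd, by
  \<open>sublinear_lower\<close>, and hence linear.\<close>

lemma norming_functional:
  fixes v :: "'a::real_normed_vector"
  obtains u :: "'a \<Rightarrow> real" where "linear u" "\<And>x. \<bar>u x\<bar> \<le> norm x" "\<bar>u v\<bar> = norm v"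
proof -
  have "sublinear (norm :: 'a \<Rightarrow> real)"
    by (rule sublinearI) (auto intro: norm_triangle_ineq)
  \<comment> \<open>The value at \<open>- v\<close> is lowered before minimising: oddness of the
    minimal \<open>u\<close> then turns \<open>u (- v) \<le> - norm v\<close> into
    \<open>norm v \<le> u v\<close>.\<close>
  from sublinear_lower[OF this, of v] obtain p
    where p: "sublinear p" "\<And>x. p x \<le> norm x" "p (- v) \<le> - norm v" by blast
  from ex_minimal_sublinear[OF p(1)] obtain u
    where u: "sublinear u" "u \<le> p" "\<And>q. sublinear q \<Longrightarrow> q \<le> u \<Longrightarrow> q = u" by blast
  have neg: "u (- x) = - u x" for x
  proof -
    obtain q where q: "sublinear q" "\<And>z. q z \<le> u z" "q (- x) \<le> - u x"
      using sublinear_lower[OF u(1), of x] by blast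
    then have "q = u" by (intro u(3)) (auto simp: le_fun_def)
    with q(3) show ?thesis using sublinear_ge[OF u(1), of x] by simp
  qed
  have le: "u x \<le> norm x" for x
    using u(2) p(2) by (meson le_fun_def order_trans)
  have abs: "\<bar>u x\<bar> \<le> norm x" for x
    using le[of x] le[of "- x"] neg[of x] by simp
  show thesis
  proof
    show "linear u"
    proof (rule linearI)
      fix x y
      show "u (x + y) = u x + u y"
        using sublinear_add[OF u(1), of x y] sublinear_add[OF u(1), of "- x" "- y"]
          neg[of x] neg[of y] neg[of "x + y"] by simp
    next
      fix c :: real and x
      show "u (c *\<^sub>R x) = c *\<^sub>R u x"
        using sublinear_scale[OF u(1), of "\<bar>c\<bar>" x] neg[of "c *\<^sub>R x"]
        by (cases "c \<ge> 0") auto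
    qed
    show "\<bar>u x\<bar> \<le> norm x" for x by (rule abs)
    have "u (- v) \<le> - norm v" using u(2) p(3) by (meson le_fun_def order_trans)
    then show "\<bar>u v\<bar> = norm v" using abs[of v] neg[of v] by simp
  qed
qed

subsection \<open>Entire functions of exponential type\<close>

text \<open>The simple zeros of \<open>s\<close> cancel against zeros of \<open>f\<close>: with
  l'Hopital's value the quotient is continuous there, and an isolated singularity at which a
  function is continuous is removable.\<close>

lemma holomorphic_on_quotient_removable:
  assumes W: "open W" and f: "f holomorphic_on W" and s: "s holomorphic_on W"
    and fin: "finite {z \<in> W. s z = 0}"
    and zero: "\<And>z. z \<in> W \<Longrightarrow> s z = 0 \<Longrightarrow> f z = 0 \<and> deriv s z \<noteq> 0"
  shows "(\<lambda>z. if s z = 0 then deriv f z / deriv s z else f z / s z) holomorphic_on W"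
    (is "?g holomorphic_on W")
proof (rule no_isolated_singularity)
  let ?K = "{z \<in> W. s z = 0}"
  have opn: "open (W - ?K)"
    using W fin by (simp add: finite_imp_closed open_Diff)
  have "(\<lambda>z. f z / s z) holomorphic_on (W - ?K)"
    using f s by (intro holomorphic_on_divide) (auto intro: holomorphic_on_subset)
  then show hol: "?g holomorphic_on (W - ?K)"
    by (rule holomorphic_transform) auto
  show "continuous_on W ?g"
    unfolding continuous_on_eq_continuous_at[OF W]
  proof
    fix a assume a: "a \<in> W"
    show "isCont ?g a"
    proof (cases "s a = 0")
      case False
      then show ?thesis
        using hol opn a continuous_on_eq_continuous_at holomorphic_on_imp_continuous_on by fastforce
    next
      case True
      have "(f has_field_derivative deriv f a) (at a)" "(s has_field_derivative deriv s a) (at a)"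
        using f s W a holomorphic_derivI by blast+
      then have "((\<lambda>z. ((f z - f a) / (z - a)) / ((s z - s a) / (z - a)))
          \<longlongrightarrow> deriv f a / deriv s a) (at a)"
        using zero[OF a True] by (intro tendsto_divide) (auto simp: has_field_derivative_iff)
      \<comment> \<open>As \<open>f a = s a = 0\<close>, the difference quotients divide to
        \<open>f z / s z\<close>; finiteness keeps the other zeros of \<open>s\<close> away from
        \<open>a\<close>.\<close>
      moreover have "\<forall>\<^sub>F z in at a. ((f z - f a) / (z - a)) / ((s z - s a) / (z - a)) = ?g z"
      proof -
        have "open (W - (?K - {a}))"
          using W fin by (simp add: finite_imp_closed open_Diff)
        then have "\<forall>\<^sub>F z in at a. z \<in> W - (?K - {a}) - {a}"
          using a by (subst eventually_at_topological) auto
        then show ?thesis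
          by (rule eventually_mono) (use True zero[OF a True] in auto)
      qed
      ultimately have "(?g \<longlongrightarrow> deriv f a / deriv s a) (at a)"
        by (rule Lim_transform_eventually)
      then show ?thesis using True by (simp add: isCont_def)
    qed
  qed
qed (use W fin in auto)

text \<open>Along the real axis the complex derivative is that of a real-valued curve, hence real.
  Differentiability of \<open>g\<close> is inherited from \<open>F\<close>.\<close>

lemma higher_deriv_of_real:
  fixes g :: "real \<Rightarrow> real"
  assumes F: "F holomorphic_on UNIV" and eq: "\<And>x. F (of_real x) = of_real (g x)"
  shows "(deriv ^^ n) F (of_real x) = of_real ((deriv ^^ n) g x)"
proof (induction n arbitrary: x)
  case 0
  then show ?case using eq by simp
next
  case (Suc n)
  define G h where "G = (deriv ^^ n) F" and "h = (deriv ^^ n) g"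
  have "G holomorphic_on UNIV"
    unfolding G_def using F by (intro holomorphic_higher_deriv) auto
  then have "(G has_field_derivative deriv G (of_real x)) (at (of_real x))"
    by (intro holomorphic_derivI) auto
  then have "((\<lambda>x. G (of_real x)) has_vector_derivative deriv G (of_real x)) (at x)"
    by (rule has_vector_derivative_real_field)
  then have D: "((\<lambda>x. complex_of_real (h x)) has_vector_derivative deriv G (of_real x)) (at x)"
    using Suc by (simp add: G_def h_def)
  have re: "(h has_vector_derivative Re (deriv G (of_real x))) (at x)"
    using bounded_linear.has_vector_derivative[OF bounded_linear_Re D] by simp
  have im: "((\<lambda>x. 0) has_vector_derivative Im (deriv G (of_real x))) (at x)"
    using bounded_linear.has_vector_derivative[OF bounded_linear_Im D] by simp
  have "Im (deriv G (of_real x)) = 0"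
    using vector_derivative_unique_at[OF im has_vector_derivative_const] by simp
  moreover have "deriv h x = Re (deriv G (of_real x))"
    using re by (intro DERIV_imp_deriv) (simp add: has_real_derivative_iff_has_vector_derivative)
  ultimately show ?case
    by (simp add: G_def h_def complex_eq_iff)
qed

section \<open>The cardinal sine as an entire function\<close>

definition csinc :: "complex \<Rightarrow> complex" where
  "csinc z = (if z = 0 then 1 else sin (of_real pi * z) / (of_real pi * z))"

lemma csinc_of_real: "csinc (of_real x) = of_real (nsinc x)"
  by (auto simp: csinc_def nsinc_def simp flip: sin_of_real)

lemma deriv_sin_pi: "deriv (\<lambda>z::complex. sin (of_real pi * z)) z = of_real pi * cos (of_real pi * z)"
  by (rule DERIV_imp_deriv) (auto intro!: derivative_eq_intros)

lemma holomorphic_csinc: "csinc holomorphic_on UNIV"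
proof -
  have "(\<lambda>z. if of_real pi * z = 0
      then deriv (\<lambda>z. sin (of_real pi * z)) z / deriv (\<lambda>z. of_real pi * z) z
      else sin (of_real pi * z) / (of_real pi * z)) holomorphic_on UNIV"
    by (intro holomorphic_on_quotient_removable holomorphic_intros) auto
  also have "(\<lambda>z. if of_real pi * z = 0
      then deriv (\<lambda>z. sin (of_real pi * z)) z / deriv (\<lambda>z. of_real pi * z) z
      else sin (of_real pi * z) / (of_real pi * z)) = csinc"
    by (auto simp: fun_eq_iff csinc_def deriv_sin_pi)
  finally show ?thesis .
qed

lemma holomorphic_csinc_diff: "(\<lambda>z. csinc (z - of_int k)) holomorphic_on A"
  by (rule holomorphic_on_compose_gen[OF _ holomorphic_csinc, unfolded o_def])
    (auto intro!: holomorphic_intros)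

text \<open>All integer shifts share the factor \<open>sin (pi z)\<close>, so a cardinal series can
  be divided by it; at the integers the shifts reduce to Kronecker deltas.\<close>

lemma csinc_diff_of_int:
  "csinc (z - of_int k) = (if z = of_int k then 1 else
     sin (of_real pi * z) * ((-1) powi k / (of_real pi * (z - of_int k))))"
proof -
  have "sin (of_real pi * (z - of_int k)) = (-1) powi k * sin (of_real pi * z)"
  proof -
    have "sin (complex_of_real pi * of_int k) = of_real (sin (pi * of_int k))"
      "cos (complex_of_real pi * of_int k) = of_real (cos (pi * of_int k))"
      by (metis of_real_mult of_real_of_int_eq sin_of_real cos_of_real)+
    moreover have "cos (pi * of_int k) = (-1) powi k"
      by (cases "k \<ge> 0") (auto simp: power_int_def simp flip: cos_npi2)
    ultimately show ?thesis
      by (simp add: right_diff_distrib sin_diff)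
  qed
  then show ?thesis by (auto simp: csinc_def)
qed

text \<open>The vanishing of the \<open>r\<close>-th derivative of \<open>s\<close> removes the only term of Leibniz' rule
  that Cauchy's inequality does not make small.\<close>

lemma higher_deriv_mult_bound:
  fixes s :: "complex \<Rightarrow> complex"
  assumes s: "s holomorphic_on UNIV" and zero: "(deriv ^^ r) s a = 0"
  obtains C where "C \<ge> 0"
    "\<And>g R B. g holomorphic_on ball a R \<Longrightarrow> continuous_on (cball a R) g \<Longrightarrow> R \<ge> 1 \<Longrightarrow>
       (\<And>z. z \<in> cball a R \<Longrightarrow> norm (g z) \<le> B) \<Longrightarrow>
       norm ((deriv ^^ r) (\<lambda>z. s z * g z) a) \<le> C * B / R"
proof
  \<comment> \<open>Independent of \<open>g\<close>, \<open>R\<close> and \<open>B\<close>, so the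
    estimate stays uniform while all three vary.\<close>
  define C where "C = (\<Sum>i=0..r. real (r choose i) * norm ((deriv ^^ i) s a) * fact (r - i))"
  show "C \<ge> 0" unfolding C_def by (intro sum_nonneg) auto
  fix g :: "complex \<Rightarrow> complex" and R B :: real
  assume g: "g holomorphic_on ball a R" "continuous_on (cball a R) g"
    and R: "R \<ge> 1" and B: "\<And>z. z \<in> cball a R \<Longrightarrow> norm (g z) \<le> B"
  have B0: "B \<ge> 0" using B[of a] R by (auto intro: order_trans[OF norm_ge_zero])
  have "(deriv ^^ r) (\<lambda>z. s z * g z) a
      = (\<Sum>i=0..r. of_nat (r choose i) * (deriv ^^ i) s a * (deriv ^^ (r - i)) g a)"
    using R by (intro higher_deriv_mult[of _ "ball a R"] g holomorphic_on_subset[OF s]) auto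
  also have "norm \<dots> \<le> (\<Sum>i=0..r. real (r choose i) * norm ((deriv ^^ i) s a) * fact (r - i) * (B / R))"
  proof (rule sum_norm_le)
    fix i assume i: "i \<in> {0..r}"
    show "norm (of_nat (r choose i) * (deriv ^^ i) s a * (deriv ^^ (r - i)) g a)
        \<le> real (r choose i) * norm ((deriv ^^ i) s a) * fact (r - i) * (B / R)"
    proof (cases "i = r")
      case True
      then show ?thesis using zero by simp
    next
      case False
      have "norm ((deriv ^^ (r - i)) g a) \<le> fact (r - i) * B / R ^ (r - i)"
        using R by (intro Cauchy_inequality g B) (auto simp: dist_norm)
      \<comment> \<open>Here \<open>r - i \<ge> 1\<close> and \<open>R \<ge> 1\<close>, so a factor
        \<open>1 / R\<close> survives.\<close>
      also have "\<dots> \<le> fact (r - i) * B / R"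
        using R B0 False i power_increasing[of 1 "r - i" R]
        by (intro divide_left_mono mult_nonneg_nonneg) auto
      finally have "norm ((deriv ^^ (r - i)) g a) \<le> fact (r - i) * (B / R)" by simp
      then show ?thesis
        unfolding norm_mult norm_of_nat mult.assoc by (intro mult_left_mono) auto
    qed
  qed
  also have "\<dots> = C * B / R"
    by (simp add: C_def sum_distrib_right sum_divide_distrib)
  finally show "norm ((deriv ^^ r) (\<lambda>z. s z * g z) a) \<le> C * B / R" .
qed

text \<open>For \<open>z = x + i y\<close> the squared modulus is
  \<open>(cosh (2 pi y) - cos (2 pi x)) / 2\<close>. On the vertical lines the cosine is -1; away
  from the real axis the exponential dominates it. Together the two cases cover the boundary of the
  square of half-width \<open>N + 1/2\<close>.\<close>

lemma sin_pi_lower_bound: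
  assumes "\<bar>Re z\<bar> = real N + 1/2 \<or> \<bar>Im z\<bar> \<ge> 1/2"
  shows "exp (pi * \<bar>Im z\<bar>) / 4 \<le> norm (sin (of_real pi * z))"
proof (rule power2_le_imp_le)
  define E where "E = exp (2 * (pi * \<bar>Im z\<bar>))"
  have E: "E \<ge> 1" unfolding E_def by simp
  have cases: "exp (2 * (pi * Im z)) + inverse (exp (2 * (pi * Im z))) = E + inverse E"
    by (auto simp: E_def abs_if exp_minus)
  have nrm: "norm (sin (of_real pi * z)) ^ 2 = (E + inverse E - 2 * cos (2 * (pi * Re z))) / 4"
    by (subst norm_sin_squared) (simp add: cases)
  have sq: "(exp (pi * \<bar>Im z\<bar>) / 4)\<^sup>2 = E / 16"
    by (simp add: E_def power_divide exp_double)
  show "(exp (pi * \<bar>Im z\<bar>) / 4)\<^sup>2 \<le> norm (sin (of_real pi * z)) ^ 2"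
    using assms
  proof
    assume "\<bar>Re z\<bar> = real N + 1/2"
    then have "cos (2 * (pi * Re z)) = cos (2 * (pi * (real N + 1/2)))"
      by (metis abs_if cos_minus mult_minus_right)
    also have "2 * (pi * (real N + 1/2)) = 2 * real N * pi + pi" by (simp add: algebra_simps)
    also have "cos \<dots> = -1" by (simp only: cos_add cos_2npi sin_2npi) simp
    finally have "cos (2 * (pi * Re z)) = -1" .
    then show ?thesis unfolding nrm sq using E by (simp add: field_simps)
  next
    assume "\<bar>Im z\<bar> \<ge> 1/2"
    then have "1 + pi * 1 \<le> 1 + pi * (2 * \<bar>Im z\<bar>)"
      by (intro add_left_mono mult_left_mono) auto
    also have "pi * (2 * \<bar>Im z\<bar>) = 2 * (pi * \<bar>Im z\<bar>)" by simp
    also have "1 + \<dots> \<le> E" unfolding E_def by (rule exp_ge_add_one_self)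
    finally have "1 + pi \<le> E" by simp
    then have "E \<ge> 4" using pi_gt3 by simp
    moreover have "cos (2 * (pi * Re z)) \<le> 1" by simp
    moreover have "inverse E \<ge> 0" using E by simp
    ultimately have "E + inverse E - 2 * cos (2 * (pi * Re z)) \<ge> E / 4" by linarith
    then show ?thesis unfolding nrm sq by simp
  qed
qed auto

section \<open>Entire extension of a real function with geometrically bounded derivatives\<close>

lemma higher_deriv_eqI:
  fixes G :: "nat \<Rightarrow> real \<Rightarrow> real"
  assumes "\<And>n x. (G n has_real_derivative G (Suc n) x) (at x)"
  shows "(deriv ^^ n) (G 0) = G n"
proof (induction n)
  case (Suc n)
  have "deriv (G n) = G (Suc n)"
    using DERIV_imp_deriv[OF assms] by (intro ext)
  with Suc.IH show ?case by simp
qed simp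

text \<open>The bounds make the Taylor series at 0 converge everywhere and its Lagrange remainder
  vanish on the real line. For the growth estimate the series is recentred at \<open>Re z\<close>,
  where the same bounds hold, so that only the distance \<open>\<bar>Im z\<bar>\<close>
  enters.\<close>

lemma entire_extension:
  fixes G :: "nat \<Rightarrow> real \<Rightarrow> real"
  assumes deriv: "\<And>n x. (G n has_real_derivative G (Suc n) x) (at x)"
    and bound: "\<And>n x. \<bar>G n x\<bar> \<le> M * c ^ n" and c: "c \<ge> 0"
  obtains F where "F holomorphic_on UNIV" "\<And>x. F (of_real x) = complex_of_real (G 0 x)"
    "\<And>z. norm (F z) \<le> M * exp (c * \<bar>Im z\<bar>)"
proof -
  have exps: "(\<lambda>n. M * c ^ n / fact n * y ^ n) sums (M * exp (c * y))" for y :: real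
  proof -
    have "M * ((c * y) ^ n /\<^sub>R fact n) = M * c ^ n / fact n * y ^ n" for n
      by (simp add: power_mult_distrib divide_inverse)
    then show ?thesis
      using sums_mult[OF exp_converges[of "c * y"], of M] by simp
  qed
  have le: "norm (of_real (G n x) / fact n * z ^ n) \<le> M * c ^ n / fact n * norm z ^ n" for n x and z :: complex
    using bound[of n x]
    by (auto simp: norm_mult norm_divide norm_power intro!: mult_right_mono divide_right_mono)
  define F where "F = (\<lambda>z::complex. \<Sum>n. of_real (G n 0) / fact n * z ^ n)"
  have F_sums: "(\<lambda>n. of_real (G n 0) / fact n * z ^ n) sums F z" for z
    unfolding F_def
    by (rule summable_sums, rule summable_comparison_test'[OF sums_summable[OF exps[of "norm z"]]])
      (rule le)
  have hol: "F holomorphic_on UNIV"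
  proof (rule holomorphic_on_subset)
    show "F holomorphic_on (\<Union>n. ball 0 (real n))"
      using F_sums
      by (intro holomorphic_on_UN_open power_series_holomorphic[where a = "\<lambda>n. of_real (G n 0) / fact n"]) auto
    show "UNIV \<subseteq> (\<Union>n. ball (0::complex) (real n))"
      by (auto simp: real_arch_simple reals_Archimedean2)
  qed
  have real: "F (of_real x) = of_real (G 0 x)" for x
  proof -
    have "(\<lambda>n. G 0 x - (\<Sum>m<n. G m 0 / fact m * x ^ m)) \<longlonglongrightarrow> 0"
    proof (rule Lim_null_comparison)
      show "(\<lambda>n. M * c ^ n / fact n * \<bar>x\<bar> ^ n) \<longlonglongrightarrow> 0"
        by (rule summable_LIMSEQ_zero[OF sums_summable[OF exps]])
      show "\<forall>\<^sub>F n in sequentially. norm (G 0 x - (\<Sum>m<n. G m 0 / fact m * x ^ m)) \<le> M * c ^ n / fact n * \<bar>x\<bar> ^ n"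
      proof (intro always_eventually allI)
        fix n
        obtain t where "G 0 x = (\<Sum>m<n. G m 0 / fact m * x ^ m) + G n t / fact n * x ^ n"
          using Maclaurin_all_le[of G "G 0" x n] deriv by blast
        then show "norm (G 0 x - (\<Sum>m<n. G m 0 / fact m * x ^ m)) \<le> M * c ^ n / fact n * \<bar>x\<bar> ^ n"
          using bound[of n t]
          by (auto simp: abs_mult power_abs intro!: mult_right_mono divide_right_mono)
      qed
    qed
    then have "(\<lambda>m. G m 0 / fact m * x ^ m) sums G 0 x"
      unfolding sums_def using tendsto_diff[OF tendsto_const[of "G 0 x"]] by force
    then have "(\<lambda>m. of_real (G m 0 / fact m * x ^ m)) sums complex_of_real (G 0 x)"
      by (rule sums_of_real)
    then show ?thesis
      using F_sums[of "of_real x"] by (simp add: sums_iff)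
  qed
  have hd: "(deriv ^^ n) (G 0) = G n" for n
    using deriv by (rule higher_deriv_eqI)
  have "norm (F z) \<le> M * exp (c * \<bar>Im z\<bar>)" for z
  proof (rule norm_sums_le)
    show "(\<lambda>n. M * c ^ n / fact n * \<bar>Im z\<bar> ^ n) sums (M * exp (c * \<bar>Im z\<bar>))" by (rule exps)
    let ?x = "complex_of_real (Re z)"
    show "(\<lambda>n. (deriv ^^ n) F ?x / fact n * (z - ?x) ^ n) sums F z"
      by (rule holomorphic_power_series[where r = "1 + norm (z - ?x)"])
        (auto simp: dist_norm norm_minus_commute intro: holomorphic_on_subset[OF hol])
    have "z - ?x = \<i> * of_real (Im z)" by (simp add: complex_eq_iff)
    then have nz: "norm (z - ?x) = \<bar>Im z\<bar>" by (simp add: norm_mult)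
    show "norm ((deriv ^^ n) F ?x / fact n * (z - ?x) ^ n) \<le> M * c ^ n / fact n * \<bar>Im z\<bar> ^ n" for n
      using le[of n "Re z" "z - ?x"] by (simp add: higher_deriv_of_real[OF hol real] hd nz)
  qed
  then show thesis using that hol real by blast
qed

subsection \<open>Derivatives of the cardinal sine\<close>

text \<open>Each differentiation advances the phase by \<open>pi / 2\<close>; in this form the zeros
  of a derivative can be read off.\<close>

lemma higher_deriv_sin_pi:
  "(deriv ^^ n) (\<lambda>z::complex. sin (of_real pi * z)) =
     (\<lambda>z. of_real pi ^ n * sin (of_real pi * z + of_real (n * pi / 2)))"
proof (induction n)
  case (Suc n)
  have "deriv (\<lambda>z::complex. of_real pi ^ n * sin (of_real pi * z + of_real (n * pi / 2))) z
      = of_real pi ^ Suc n * cos (of_real pi * z + of_real (n * pi / 2))" for z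
    by (rule DERIV_imp_deriv) (auto intro!: derivative_eq_intros)
  moreover have "cos (of_real pi * z + of_real (n * pi / 2)) = sin (of_real pi * z + of_real (Suc n * pi / 2))" for z :: complex
  proof -
    have "of_real pi * z + of_real (Suc n * pi / 2) = (of_real pi * z + of_real (n * pi / 2)) + of_real (pi / 2)"
      by (simp add: field_simps)
    also have "sin \<dots> = cos (of_real pi * z + of_real (n * pi / 2))"
      by (simp only: sin_add sin_of_real cos_of_real) simp
    finally show ?thesis by simp
  qed
  ultimately show ?case by (simp add: Suc fun_eq_iff)
qed simp

lemma higher_deriv_csinc_diff:
  "(deriv ^^ r) (\<lambda>z. csinc (z - of_int k)) (of_real \<delta>) = of_real ((deriv ^^ r) nsinc (\<delta> - of_int k))"
proof -
  have "(deriv ^^ r) (\<lambda>z. csinc (1 * z + - of_int k)) (of_real \<delta>)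
      = 1 ^ r * (deriv ^^ r) csinc (1 * of_real \<delta> + - of_int k)"
    by (rule higher_deriv_compose_linear'[OF holomorphic_csinc, where S = UNIV]) auto
  also have "1 * complex_of_real \<delta> + - of_int k = of_real (\<delta> - of_int k)" by simp
  finally show ?thesis
    using higher_deriv_of_real[OF holomorphic_csinc csinc_of_real, of r "\<delta> - of_int k"] by simp
qed

section \<open>Absolute summability of the coefficients\<close>

lemma inverse_squares_summable_on_int: "(\<lambda>k::int. 1 / (real_of_int k)\<^sup>2) summable_on UNIV"
proof -
  \<comment> \<open>The term at 0 is \<open>1 / 0 = 0\<close>, so index 0 may stay in the
    sum.\<close>
  have nat: "(\<lambda>n. 1 / (real n)\<^sup>2) summable_on UNIV"
    using inverse_power_summable[of 2, where 'a = real]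
    by (intro summable_nonneg_imp_summable_on) (auto simp: divide_inverse)
  have "(\<lambda>n. 1 / (real (Suc n))\<^sup>2) summable_on UNIV"
    using inverse_power_summable[of 2, where 'a = real] summable_Suc_iff[of "\<lambda>n. inverse (real n ^ 2)"]
    by (intro summable_nonneg_imp_summable_on) (auto simp: divide_inverse)
  then have "(\<lambda>k::int. 1 / (real_of_int k)\<^sup>2) summable_on (\<lambda>n. - int (Suc n)) ` UNIV"
    by (subst summable_on_reindex) (auto simp: inj_on_def o_def power2_commute[of "- 1"] add.commute)
  moreover have "(\<lambda>k::int. 1 / (real_of_int k)\<^sup>2) summable_on int ` UNIV"
    using nat by (subst summable_on_reindex) (auto simp: inj_on_def o_def)
  moreover have "int ` UNIV \<union> (\<lambda>n. - int (Suc n)) ` UNIV = UNIV"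
  proof -
    have "k \<in> int ` UNIV \<union> (\<lambda>n. - int (Suc n)) ` UNIV" for k
      by (cases k rule: int_cases) auto
    then show ?thesis by auto
  qed
  moreover have "int ` UNIV \<inter> (\<lambda>n. - int (Suc n)) ` UNIV = {}" by auto
  ultimately show ?thesis by (metis summable_on_Un_disjoint)
qed

text \<open>The coefficients decay like \<open>1 / k^2\<close>: near \<delta> the shifted sinc is
  \<open>sin (pi z)\<close> times a function of size \<open>O(1 / k)\<close> on a disc of radius
  \<open>\<bar>k\<bar> / 4\<close>, and \<open>higher_deriv_mult_bound\<close> gains another factor
  \<open>1 / k\<close> because the leading Leibniz term vanishes.\<close>

lemma nsinc_higher_deriv_abs_summable:
  assumes zero: "(deriv ^^ r) (\<lambda>z::complex. sin (of_real pi * z)) (of_real \<delta>) = 0"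
  shows "(\<lambda>k::int. norm ((deriv ^^ r) nsinc (\<delta> - of_int k))) summable_on UNIV"
proof -
  have "(\<lambda>z::complex. sin (of_real pi * z)) holomorphic_on UNIV" by (intro holomorphic_intros)
  from higher_deriv_mult_bound[OF this zero] obtain C where
    C: "C \<ge> 0" "\<And>g R B. g holomorphic_on ball (of_real \<delta>) R \<Longrightarrow> continuous_on (cball (of_real \<delta>) R) g \<Longrightarrow> R \<ge> 1 \<Longrightarrow>
       (\<And>z. z \<in> cball (of_real \<delta>) R \<Longrightarrow> norm (g z) \<le> B) \<Longrightarrow>
       norm ((deriv ^^ r) (\<lambda>z. sin (of_real pi * z) * g z) (of_real \<delta>)) \<le> C * B / R" by blast
  \<comment> \<open>Outside this finite set the radius \<open>\<bar>k\<bar> / 4\<close> is at least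
    1, and the disc of that radius about \<delta> keeps the same distance from
    \<open>k\<close>.\<close>
  define F where "F = {k::int. \<bar>real_of_int k\<bar> < 4 + 2 * \<bar>\<delta>\<bar>}"
  have "finite F"
    by (rule finite_subset[of _ "{- \<lceil>4 + 2 * \<bar>\<delta>\<bar>\<rceil>..\<lceil>4 + 2 * \<bar>\<delta>\<bar>\<rceil>}"]) (auto simp: F_def, linarith+)
  \<comment> \<open>The factor 16 is \<open>1 / R^2\<close> for
    \<open>R = \<bar>k\<bar> / 4\<close>.\<close>
  have bound: "\<bar>(deriv ^^ r) nsinc (\<delta> - of_int k)\<bar> \<le> 16 * C * (1 / (real_of_int k)\<^sup>2)" if "k \<notin> F" for k
  proof -
    define R where "R = \<bar>real_of_int k\<bar> / 4"
    from that have k: "\<bar>real_of_int k\<bar> \<ge> 4 + 2 * \<bar>\<delta>\<bar>" by (simp add: F_def)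
    then have R: "R \<ge> 1" by (simp add: R_def)
    define g where "g = (\<lambda>z::complex. (-1) powi k / (of_real pi * (z - of_int k)))"
    have dist: "norm (z - of_int k) \<ge> R" if "z \<in> cball (of_real \<delta>) R" for z :: complex
    proof -
      have "norm (of_int k - of_real \<delta> :: complex) = \<bar>real_of_int k - \<delta>\<bar>"
        by (metis norm_of_real of_real_diff of_real_of_int_eq)
      moreover have "\<bar>real_of_int k - \<delta>\<bar> \<ge> 2 * R" using k abs_triangle_ineq2[of "real_of_int k" \<delta>] by (simp add: R_def)
      moreover have "norm (of_real \<delta> - z) \<le> R" using that by (simp add: dist_norm)
      moreover have "norm (of_int k - of_real \<delta> :: complex) \<le> norm (z - of_int k) + norm (of_real \<delta> - z)"
        using norm_triangle_ineq[of "of_int k - z" "z - complex_of_real \<delta>"]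
        by (simp add: norm_minus_commute)
      ultimately show ?thesis by linarith
    qed
    then have ne: "z \<noteq> of_int k" if "z \<in> cball (of_real \<delta>) R" for z :: complex
      using that R by force
    have hol: "g holomorphic_on ball (of_real \<delta>) R"
      unfolding g_def using ne by (intro holomorphic_intros) force
    have "continuous_on (cball (of_real \<delta>) R) g"
      unfolding g_def using ne by (intro continuous_intros) auto
    moreover have "norm (g z) \<le> 1 / R" if "z \<in> cball (of_real \<delta>) R" for z
    proof -
      have "1 * R \<le> pi * norm (z - of_int k)"
        using dist[OF that] R pi_gt3 by (intro mult_mono) auto
      then show ?thesis
        using R by (simp add: g_def norm_divide norm_mult norm_power_int frac_le)
    qed
    ultimately have *: "norm ((deriv ^^ r) (\<lambda>z. sin (of_real pi * z) * g z) (of_real \<delta>)) \<le> C * (1 / R) / R"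
      by (intro C hol R)
    have "(deriv ^^ r) (\<lambda>z. csinc (z - of_int k)) (of_real \<delta>) = (deriv ^^ r) (\<lambda>z. sin (of_real pi * z) * g z) (of_real \<delta>)"
    proof (rule higher_deriv_transform_within_open[where S = "ball (of_real \<delta>) R"])
      show "(\<lambda>z. csinc (z - of_int k)) holomorphic_on ball (of_real \<delta>) R"
        by (rule holomorphic_csinc_diff)
      show "csinc (z - of_int k) = sin (of_real pi * z) * g z" if "z \<in> ball (of_real \<delta>) R" for z
        using ne[of z] that by (simp add: csinc_diff_of_int g_def)
    qed (use R in \<open>auto intro!: holomorphic_intros hol\<close>)
    with * have "norm (complex_of_real ((deriv ^^ r) nsinc (\<delta> - of_int k))) \<le> C * (1 / R) / R"
      by (simp only: higher_deriv_csinc_diff)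
    then show ?thesis
      by (simp add: R_def power2_eq_square)
  qed
  have "(\<lambda>k::int. norm (16 * C * (1 / (real_of_int k)\<^sup>2))) summable_on UNIV"
    using summable_on_cmult_right[OF inverse_squares_summable_on_int, of "16 * C"] C(1)
    by simp
  then have "(\<lambda>k::int. norm (16 * C * (1 / (real_of_int k)\<^sup>2))) summable_on (- F)"
    by (rule summable_on_subset_banach) auto
  then have "(\<lambda>k::int. norm ((deriv ^^ r) nsinc (\<delta> - of_int k))) summable_on (- F)"
    by (rule Infinite_Sum.abs_summable_on_comparison_test) (use bound C(1) in \<open>auto intro: order_trans[OF _ abs_ge_self]\<close>)
  moreover have "(\<lambda>k::int. norm ((deriv ^^ r) nsinc (\<delta> - of_int k))) summable_on F"
    using \<open>finite F\<close> by simp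
  ultimately have "(\<lambda>k::int. norm ((deriv ^^ r) nsinc (\<delta> - of_int k))) summable_on (F \<union> - F)"
    by (intro summable_on_Un_disjoint) auto
  then show ?thesis by simp
qed

section \<open>Sums of reciprocal distances to the nodes\<close>

lemma sum_symmetric_int:
  "(\<Sum>k\<in>{- int N..int N}. f (nat \<bar>k\<bar>)) = (f 0 + 2 * (\<Sum>j=1..N. f j) :: real)"
proof (induction N)
  case (Suc N)
  have "{- int (Suc N)..int (Suc N)} = insert (int (Suc N)) (insert (- int (Suc N)) {- int N..int N})"
    by auto
  moreover have "nat (1 + int N) = Suc N" "nat (int N + 1) = Suc N" by auto
  ultimately show ?case using Suc by simp
qed simp

text \<open>The true growth is logarithmic. The square root telescopes easily and suffices, since
  the bound is later divided by a radius proportional to \<open>N\<close>.\<close>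

lemma sum_inverse_half_odd_le: "(\<Sum>j<n. 1 / (real j + 1/2)) \<le> 4 * sqrt n"
proof (induction n)
  case (Suc n)
  define a b where "a = sqrt (real n)" and "b = sqrt (real n + 1)"
  have ab: "a \<ge> 0" "b \<ge> 1" "a \<le> b" "a\<^sup>2 = real n" "b\<^sup>2 = real n + 1"
    by (auto simp: a_def b_def)
  \<comment> \<open>The increment \<open>b - a\<close> of the square root is at least
    \<open>1 / (2 b)\<close>.\<close>
  have "1 = (b - a) * (b + a)" using ab by (simp add: algebra_simps power2_eq_square)
  also have "\<dots> \<le> (b - a) * (2 * b)" using ab by (intro mult_left_mono) auto
  finally have 1: "1 / b \<le> 2 * (b - a)" using ab by (simp add: field_simps)
  have "b * 1 \<le> b * b" using ab by (intro mult_left_mono) auto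
  then have "b / 2 \<le> real n + 1/2" using ab(5) by (simp add: power2_eq_square)
  then have "1 / (real n + 1/2) \<le> 2 / b"
    using ab by (simp add: field_simps)
  with 1 have "1 / (real n + 1/2) \<le> 4 * (b - a)" by simp
  with Suc show ?case by (simp add: a_def b_def add.commute)
qed simp

text \<open>The denominators bound from below the distance of node \<open>k\<close> to the boundary
  of the square. Folding at 0 and reversing the order reduces to
  \<open>sum_inverse_half_odd_le\<close>; the constant 2 covers the central term, largest for
  \<open>N = 0\<close>.\<close>

lemma sum_inverse_distance_le:
  "(\<Sum>k\<in>{- int N..int N}. 1 / (real N + 1/2 - \<bar>real_of_int k\<bar>)) \<le> 2 + 8 * sqrt N"
proof -
  have "(\<Sum>k\<in>{- int N..int N}. 1 / (real N + 1/2 - \<bar>real_of_int k\<bar>))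
      = (\<Sum>k\<in>{- int N..int N}. (\<lambda>j. 1 / (real N + 1/2 - real j)) (nat \<bar>k\<bar>))"
    by (intro sum.cong) auto
  also have "\<dots> = 1 / (real N + 1/2) + 2 * (\<Sum>j=1..N. 1 / (real N + 1/2 - real j))"
    by (subst sum_symmetric_int) simp
  also have "(\<Sum>j=1..N. 1 / (real N + 1/2 - real j)) = (\<Sum>j<N. 1 / (real j + 1/2))"
    by (rule sum.reindex_bij_witness[of _ "\<lambda>j. N - j" "\<lambda>j. N - j"]) (auto simp: of_nat_diff)
  also have "1 / (real N + 1/2) + 2 * (\<Sum>j<N. 1 / (real j + 1/2)) \<le> 2 + 2 * (4 * sqrt N)"
    by (intro add_mono mult_left_mono sum_inverse_half_odd_le) (auto simp: field_simps)
  finally show ?thesis by simp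
qed

subsection \<open>Term-by-term differentiation of the cardinal series\<close>

lemma finite_zeros_sin_pi:
  "finite {z \<in> {z. \<bar>Re z\<bar> < c}. sin (of_real pi * z) = 0}"
proof (rule finite_subset)
  show "{z \<in> {z. \<bar>Re z\<bar> < c}. sin (of_real pi * z) = 0} \<subseteq> of_int ` {- \<lceil>c\<rceil>..\<lceil>c\<rceil>}"
  proof
    fix z :: complex
    assume z: "z \<in> {z \<in> {z. \<bar>Re z\<bar> < c}. sin (of_real pi * z) = 0}"
    then obtain k :: int where "of_real pi * z = of_real (k * pi)" by (auto simp: sin_eq_0)
    then have k: "z = of_int k" by simp
    with z have "\<bar>real_of_int k\<bar> < c" by simp
    then have "k \<in> {- \<lceil>c\<rceil>..\<lceil>c\<rceil>}" by (auto, linarith+)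
    with k show "z \<in> of_int ` {- \<lceil>c\<rceil>..\<lceil>c\<rceil>}" by blast
  qed
qed simp

lemma higher_deriv_sum_cmult:
  fixes f :: "'i \<Rightarrow> complex \<Rightarrow> complex"
  assumes "finite K" "\<And>k. k \<in> K \<Longrightarrow> f k holomorphic_on UNIV"
  shows "(deriv ^^ r) (\<lambda>z. \<Sum>k\<in>K. c k * f k z) z = (\<Sum>k\<in>K. c k * (deriv ^^ r) (f k) z)"
  using assms
proof (induction K)
  case empty
  have "(deriv ^^ r) (\<lambda>z::complex. 0::complex) = (\<lambda>z. 0)" by (induction r) auto
  then show ?case by simp
next
  case (insert k K)
  have "(deriv ^^ r) (\<lambda>z. c k * f k z + (\<Sum>k\<in>K. c k * f k z)) z
      = (deriv ^^ r) (\<lambda>z. c k * f k z) z + (deriv ^^ r) (\<lambda>z. \<Sum>k\<in>K. c k * f k z) z"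
    using insert.prems by (intro higher_deriv_add[where S = UNIV] holomorphic_intros) auto
  then show ?case
    using insert by (simp add: higher_deriv_cmult[where A = UNIV])
qed

text \<open>In the strip the zeros of \<open>sin (pi z)\<close> are exactly the interpolated nodes,
  so the quotient is holomorphic there. On the boundary of the square \<psi> contributes
  \<open>4 * M\<close> and the nodes \<open>M * (2 + 8 * sqrt N)\<close>; the maximum principle
  carries the bound inside.\<close>

lemma sinc_remainder_quotient:
  fixes \<psi> :: "complex \<Rightarrow> complex" and M :: real
  assumes hol: "\<psi> holomorphic_on UNIV" and bound: "\<And>z. norm (\<psi> z) \<le> M * exp (pi * \<bar>Im z\<bar>)"
  obtains g where "g holomorphic_on {z. \<bar>Re z\<bar> < real N + 1}"
    "\<And>z. \<bar>Re z\<bar> < real N + 1 \<Longrightarrow>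
      \<psi> z - (\<Sum>k\<in>{- int N..int N}. \<psi> (of_int k) * csinc (z - of_int k)) = sin (of_real pi * z) * g z"
    "\<And>z. norm z \<le> real N \<Longrightarrow> norm (g z) \<le> M * (6 + 8 * sqrt N)"
proof
  \<comment> \<open>Wide enough to contain the closed square of half-width \<open>N + 1/2\<close>,
    but no integer beyond \<open>\<plusminus>N\<close>.\<close>
  define W where "W = {z. \<bar>Re z\<bar> < real N + 1}"
  define Q where "Q = (\<lambda>z. \<psi> z - (\<Sum>k\<in>{- int N..int N}. \<psi> (of_int k) * csinc (z - of_int k)))"
  define s where "s = (\<lambda>z. sin (complex_of_real pi * z))"
  define g where "g = (\<lambda>z. if s z = 0 then deriv Q z / deriv s z else Q z / s z)"
  have M: "M \<ge> 0" using order_trans[OF norm_ge_zero bound[of 0]] by simp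
  have W: "open W"
    unfolding W_def by (intro open_Collect_less continuous_intros)
  have sol: "s holomorphic_on A" for A unfolding s_def by (intro holomorphic_intros)
  have Qhol: "Q holomorphic_on W"
    unfolding Q_def by (intro holomorphic_intros holomorphic_csinc_diff holomorphic_on_subset[OF hol]) auto
  have zeros: "Q z = 0 \<and> deriv s z \<noteq> 0" if z: "z \<in> W" "s z = 0" for z
  proof -
    from z(2) obtain k :: int where "of_real pi * z = of_real (k * pi)" by (auto simp: s_def sin_eq_0)
    then have k: "z = of_int k" by simp
    with z(1) have "\<bar>real_of_int k\<bar> < real N + 1" by (simp add: W_def)
    then have "\<bar>k\<bar> < int N + 1" by linarith
    then have kN: "k \<in> {- int N..int N}" by auto
    \<comment> \<open>At a node only the summand of that node survives, and it equals
      \<open>\<psi> z\<close>.\<close>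
    have "(\<Sum>j\<in>{- int N..int N}. \<psi> (of_int j) * csinc (z - of_int j))
        = (\<Sum>j\<in>{- int N..int N}. if j = k then \<psi> z else 0)"
      using z(2) by (intro sum.cong) (auto simp: csinc_diff_of_int k s_def)
    then have "Q z = 0" using kN by (simp add: Q_def)
    moreover have "deriv s z \<noteq> 0"
      using z(2) sin_cos_squared_add[of "of_real pi * z"] by (auto simp: s_def deriv_sin_pi)
    ultimately show ?thesis by simp
  qed
  have ghol: "g holomorphic_on W"
    unfolding g_def using finite_zeros_sin_pi[of "real N + 1"]
    by (intro holomorphic_on_quotient_removable W Qhol sol zeros) (auto simp: W_def s_def)
  then show "g holomorphic_on {z. \<bar>Re z\<bar> < real N + 1}" by (simp add: W_def)
  show "\<psi> z - (\<Sum>k\<in>{- int N..int N}. \<psi> (of_int k) * csinc (z - of_int k)) = sin (of_real pi * z) * g z"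
    if "\<bar>Re z\<bar> < real N + 1" for z
    using that zeros[of z] by (auto simp: g_def W_def Q_def s_def)
  \<comment> \<open>A half-integer keeps the vertical sides midway between zeros of the
    sine.\<close>
  define b where "b = real N + 1/2"
  define S where "S = cbox (Complex (- b) (- b)) (Complex b b)"
  have SW: "S \<subseteq> W" by (auto simp: S_def W_def in_cbox_complex_iff b_def)
  have frontier: "norm (g z) \<le> M * (6 + 8 * sqrt N)" if "z \<in> frontier S" for z
  proof -
    have z: "\<bar>Re z\<bar> = b \<or> \<bar>Im z\<bar> = b" "\<bar>Re z\<bar> \<le> b" "\<bar>Im z\<bar> \<le> b"
      using that by (auto simp: S_def frontier_cbox in_cbox_complex_iff in_box_complex_iff)
    have lower: "exp (pi * \<bar>Im z\<bar>) / 4 \<le> norm (s z)"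
      unfolding s_def using z by (intro sin_pi_lower_bound[of z N]) (auto simp: b_def)
    moreover have "exp (pi * \<bar>Im z\<bar>) > 0" by simp
    ultimately have sz: "norm (s z) > 0" by linarith
    have "norm (\<psi> z) \<le> M * (4 * norm (s z))"
      using bound[of z] lower M by (intro order_trans[OF bound[of z]] mult_left_mono) auto
    then have 1: "norm (\<psi> z / s z) \<le> 4 * M"
      using sz by (simp add: norm_divide field_simps)
    \<comment> \<open>Dividing by \<open>s z\<close> cancels the sine in the shifted sinc; what
      remains is controlled by the distance of \<open>z\<close> to \<open>k\<close>, on vertical and
      horizontal sides alike.\<close>
    have 2: "norm (\<psi> (of_int k) * csinc (z - of_int k) / s z) \<le> M * (1 / (b - \<bar>real_of_int k\<bar>))"
      if k: "k \<in> {- int N..int N}" for k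
    proof -
      have bk: "b - \<bar>real_of_int k\<bar> > 0" using k by (auto simp: b_def)
      have "b - \<bar>real_of_int k\<bar> \<le> norm (z - of_int k)"
        using z(1)
      proof
        assume "\<bar>Re z\<bar> = b"
        then have "b - \<bar>real_of_int k\<bar> \<le> \<bar>Re (z - of_int k)\<bar>" by simp
        then show ?thesis using abs_Re_le_cmod order_trans by blast
      next
        assume "\<bar>Im z\<bar> = b"
        then have "b - \<bar>real_of_int k\<bar> \<le> \<bar>Im (z - of_int k)\<bar>" by simp
        then show ?thesis using abs_Im_le_cmod order_trans by blast
      qed
      then have dist: "1 * (b - \<bar>real_of_int k\<bar>) \<le> pi * norm (z - of_int k)"
        using bk pi_gt3 by (intro mult_mono) auto
      then have "z \<noteq> of_int k" using bk by auto
      then have "csinc (z - of_int k) / s z = (-1) powi k / (of_real pi * (z - of_int k))"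
        using sz by (simp add: csinc_diff_of_int s_def)
      also have "norm \<dots> \<le> 1 / (b - \<bar>real_of_int k\<bar>)"
        using dist bk by (simp add: norm_divide norm_mult norm_power_int frac_le)
      finally have "norm (csinc (z - of_int k) / s z) \<le> 1 / (b - \<bar>real_of_int k\<bar>)" .
      moreover have "norm (\<psi> (of_int k)) \<le> M" using bound[of "of_int k"] by simp
      ultimately have "norm (\<psi> (of_int k)) * norm (csinc (z - of_int k) / s z) \<le> M * (1 / (b - \<bar>real_of_int k\<bar>))"
        using M by (intro mult_mono) auto
      then show ?thesis by (simp add: norm_mult norm_divide)
    qed
    have "g z = \<psi> z / s z - (\<Sum>k\<in>{- int N..int N}. \<psi> (of_int k) * csinc (z - of_int k) / s z)"
      using sz by (simp add: g_def Q_def diff_divide_distrib sum_divide_distrib)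
    also have "norm \<dots> \<le> 4 * M + (\<Sum>k\<in>{- int N..int N}. M * (1 / (b - \<bar>real_of_int k\<bar>)))"
      by (intro order_trans[OF norm_triangle_ineq4] add_mono 1 sum_norm_le 2)
    also have "\<dots> \<le> 4 * M + M * (2 + 8 * sqrt N)"
      unfolding sum_distrib_left[symmetric] b_def
      by (intro add_mono mult_left_mono sum_inverse_distance_le M) auto
    finally show ?thesis by (simp add: algebra_simps)
  qed
  show "norm (g z) \<le> M * (6 + 8 * sqrt N)" if "norm z \<le> real N" for z
  proof (rule maximum_modulus_frontier[where S = S and f = g and \<xi> = z])
    show "g holomorphic_on interior S"
      using SW interior_subset by (intro holomorphic_on_subset[OF ghol]) blast
    show "continuous_on (closure S) g"
      using SW by (intro continuous_on_subset[OF holomorphic_on_imp_continuous_on[OF ghol]])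
        (simp add: S_def)
    show "bounded S" by (simp add: S_def)
    have "\<bar>Re z\<bar> \<le> b" "\<bar>Im z\<bar> \<le> b"
      unfolding b_def using that abs_Re_le_cmod[of z] abs_Im_le_cmod[of z] by linarith+
    then show "z \<in> S"
      by (simp add: S_def in_cbox_complex_iff abs_le_iff minus_le_iff)
  qed (rule frontier)
qed

text \<open>The remainder estimate identifies the limit of the symmetric partial sums; absolute
  summability gives unconditional convergence, so both limits agree.\<close>

theorem nsinc_derivative_interpolation:
  fixes G :: "nat \<Rightarrow> real \<Rightarrow> real" and M :: real
  assumes deriv: "\<And>n x. (G n has_real_derivative G (Suc n) x) (at x)"
    and bound: "\<And>n x. \<bar>G n x\<bar> \<le> M * pi ^ n"
    and zero: "(deriv ^^ r) (\<lambda>z::complex. sin (of_real pi * z)) (of_real \<delta>) = 0"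
  shows "((\<lambda>k::int. (deriv ^^ r) nsinc (\<delta> - of_int k) * G 0 (of_int k)) has_sum G r \<delta>) UNIV"
proof -
  let ?c = "\<lambda>k::int. (deriv ^^ r) nsinc (\<delta> - of_int k)"
  let ?K = "\<lambda>N. {- int N..int N}"
  obtain \<psi> where \<psi>: "\<psi> holomorphic_on UNIV" "\<And>x. \<psi> (of_real x) = complex_of_real (G 0 x)"
    "\<And>z. norm (\<psi> z) \<le> M * exp (pi * \<bar>Im z\<bar>)"
    using entire_extension[OF deriv bound] pi_ge_zero by blast
  have hd: "(deriv ^^ n) (G 0) = G n" for n
    using deriv by (rule higher_deriv_eqI)
  have "(\<lambda>z::complex. sin (of_real pi * z)) holomorphic_on UNIV" by (intro holomorphic_intros)
  from higher_deriv_mult_bound[OF this zero] obtain C where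
    C: "C \<ge> 0" "\<And>g R B. g holomorphic_on ball (of_real \<delta>) R \<Longrightarrow> continuous_on (cball (of_real \<delta>) R) g \<Longrightarrow> R \<ge> 1 \<Longrightarrow>
       (\<And>z. z \<in> cball (of_real \<delta>) R \<Longrightarrow> norm (g z) \<le> B) \<Longrightarrow>
       norm ((deriv ^^ r) (\<lambda>z. sin (of_real pi * z) * g z) (of_real \<delta>)) \<le> C * B / R" by blast
  \<comment> \<open>The threshold on \<open>N\<close> makes the radius \<open>N / 2\<close> at least
    1 and places the disc about \<delta> inside \<open>norm z \<le> N\<close>, where the bound on
    \<open>g\<close> holds.\<close>
  have err: "\<bar>G r \<delta> - (\<Sum>k\<in>?K N. ?c k * G 0 (of_int k))\<bar> \<le> C * (M * (6 + 8 * sqrt N)) / (real N / 2)"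
    if N: "real N \<ge> 2 + 2 * \<bar>\<delta>\<bar>" for N
  proof -
    define Q where "Q = (\<lambda>z. \<psi> z - (\<Sum>k\<in>?K N. \<psi> (of_int k) * csinc (z - of_int k)))"
    let ?W = "{z. \<bar>Re z\<bar> < real N + 1}"
    obtain g where g: "g holomorphic_on ?W"
      "\<And>z. \<bar>Re z\<bar> < real N + 1 \<Longrightarrow> Q z = sin (of_real pi * z) * g z"
      "\<And>z. norm z \<le> real N \<Longrightarrow> norm (g z) \<le> M * (6 + 8 * sqrt N)"
      using sinc_remainder_quotient[OF \<psi>(1,3), of N] unfolding Q_def by blast
    have small: "norm z \<le> real N" if "z \<in> cball (of_real \<delta>) (real N / 2)" for z :: complex
    proof -
      have "norm (of_real \<delta> - z) \<le> real N / 2" using that by (simp add: dist_norm)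
      moreover have "norm z \<le> norm (of_real \<delta> :: complex) + norm (of_real \<delta> - z)"
        by (metis add.commute norm_minus_commute norm_triangle_sub)
      ultimately show ?thesis using N by simp
    qed
    have sub: "cball (of_real \<delta>) (real N / 2) \<subseteq> ?W"
      using small abs_Re_le_cmod by (fastforce intro: order.strict_trans1[of _ "real N"] order_trans)
    have sub': "ball (of_real \<delta>) (real N / 2) \<subseteq> ?W"
      using sub ball_subset_cball by blast
    have "norm ((deriv ^^ r) (\<lambda>z. sin (of_real pi * z) * g z) (of_real \<delta>)) \<le> C * (M * (6 + 8 * sqrt N)) / (real N / 2)"
      using N by (intro C holomorphic_on_subset[OF g(1)] sub' g(3) small
          continuous_on_subset[OF holomorphic_on_imp_continuous_on[OF g(1)]] sub) auto
    also have "(deriv ^^ r) (\<lambda>z. sin (of_real pi * z) * g z) (of_real \<delta>) = (deriv ^^ r) Q (of_real \<delta>)"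
    proof (rule higher_deriv_transform_within_open[where S = "ball (of_real \<delta>) (real N / 2)"])
      show "Q holomorphic_on ball (of_real \<delta>) (real N / 2)"
        unfolding Q_def by (intro holomorphic_intros holomorphic_csinc_diff holomorphic_on_subset[OF \<psi>(1)]) auto
      show "sin (of_real pi * z) * g z = Q z" if "z \<in> ball (of_real \<delta>) (real N / 2)" for z
        using g(2)[of z] that sub' by auto
    qed (use N sub' in \<open>auto intro!: holomorphic_intros holomorphic_on_subset[OF g(1)]\<close>)
    also have "(deriv ^^ r) Q (of_real \<delta>) = (deriv ^^ r) \<psi> (of_real \<delta>)
        - (deriv ^^ r) (\<lambda>z. \<Sum>k\<in>?K N. \<psi> (of_int k) * csinc (z - of_int k)) (of_real \<delta>)"
      unfolding Q_def by (rule higher_deriv_diff[where S = UNIV])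
        (auto intro!: holomorphic_intros holomorphic_csinc_diff \<psi>(1))
    also have "\<dots> = of_real (G r \<delta> - (\<Sum>k\<in>?K N. ?c k * G 0 (of_int k)))"
    proof -
      have "\<psi> (of_int k) = of_real (G 0 (of_int k))" for k
        using \<psi>(2)[of "of_int k"] by simp
      then show ?thesis
        using higher_deriv_sum_cmult[of "?K N" "\<lambda>k z. csinc (z - of_int k)" r "\<lambda>k. \<psi> (of_int k)"]
        by (simp add: holomorphic_csinc_diff higher_deriv_csinc_diff higher_deriv_of_real[OF \<psi>(1,2)] hd mult.commute)
    qed
    finally show ?thesis by (simp only: norm_of_real)
  qed
  have "(\<lambda>N. C * (M * (6 + 8 * sqrt (real N))) / (real N / 2)) \<longlonglongrightarrow> 0"
  proof -
    have "(\<lambda>N. 12 * C * M / real N + 16 * C * M / sqrt (real N)) \<longlonglongrightarrow> 0"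
      by (intro tendsto_add_zero tendsto_divide_0[OF tendsto_const] filterlim_at_top_imp_at_infinity
          filterlim_real_sequentially filterlim_compose[OF sqrt_at_top])
    moreover have "12 * C * M / real N + 16 * C * M / sqrt (real N) = C * (M * (6 + 8 * sqrt (real N))) / (real N / 2)" for N
      by (cases "N = 0") (auto simp: field_simps simp flip: real_sqrt_mult_self[of "real N", symmetric])
    ultimately show ?thesis by simp
  qed
  moreover have "\<forall>\<^sub>F N in sequentially. real N \<ge> 2 + 2 * \<bar>\<delta>\<bar>"
    using filterlim_real_sequentially by (auto simp: filterlim_at_top)
  then have "\<forall>\<^sub>F N in sequentially. norm (G r \<delta> - (\<Sum>k\<in>?K N. ?c k * G 0 (of_int k)))
      \<le> C * (M * (6 + 8 * sqrt N)) / (real N / 2)"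
    by (rule eventually_mono) (use err in simp)
  ultimately have "(\<lambda>N. G r \<delta> - (\<Sum>k\<in>?K N. ?c k * G 0 (of_int k))) \<longlonglongrightarrow> 0"
    by (rule Lim_null_comparison[rotated])
  then have lim: "(\<lambda>N. \<Sum>k\<in>?K N. ?c k * G 0 (of_int k)) \<longlonglongrightarrow> G r \<delta>"
    using tendsto_diff[OF tendsto_const[of "G r \<delta>"]] by force
  have M: "M \<ge> 0" using bound[of 0 0] by simp
  have "(\<lambda>k. norm (?c k) * M) summable_on UNIV"
    by (intro summable_on_cmult_left nsinc_higher_deriv_abs_summable zero)
  then have "(\<lambda>k. norm (norm (?c k) * M)) summable_on UNIV"
    using M by (simp add: abs_mult)
  then have "(\<lambda>k. norm (?c k * G 0 (of_int k))) summable_on UNIV"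
  proof (rule Infinite_Sum.abs_summable_on_comparison_test)
    show "norm (?c k * G 0 (of_int k)) \<le> norm (norm (?c k) * M)" for k
      using mult_left_mono[OF bound[of 0 "of_int k"], of "\<bar>?c k\<bar>"] M by (simp add: abs_mult)
  qed
  then obtain S where S: "((\<lambda>k. ?c k * G 0 (of_int k)) has_sum S) UNIV"
    using abs_summable_summable summable_on_def by blast
  \<comment> \<open>The symmetric intervals are cofinal among the finite sets of integers, so they
    detect the unconditional sum.\<close>
  have "filterlim ?K (finite_subsets_at_top UNIV) sequentially"
    unfolding filterlim_finite_subsets_at_top
  proof (intro allI impI)
    fix X :: "int set" assume X: "finite X \<and> X \<subseteq> UNIV"
    define m where "m = Max (abs ` X)"
    have m: "\<bar>x\<bar> \<le> m" if "x \<in> X" for x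
      unfolding m_def using X that by (intro Max_ge) auto
    show "\<forall>\<^sub>F N in sequentially. finite (?K N) \<and> X \<subseteq> ?K N \<and> ?K N \<subseteq> UNIV"
      using eventually_ge_at_top[of "nat m"]
    proof eventually_elim
      case (elim N)
      then show ?case using m by (force simp: abs_le_iff)
    qed
  qed
  from filterlim_compose[OF S[unfolded has_sum_def] this]
  have "(\<lambda>N. \<Sum>k\<in>?K N. ?c k * G 0 (of_int k)) \<longlonglongrightarrow> S" .
  with lim have "S = G r \<delta>" using LIMSEQ_unique by blast
  with S show ?thesis by simp
qed

subsection \<open>Groups of isometries\<close>

context isometry_group
begin

lemma bounded_linear: "bounded_linear (T t)"
proof (rule bounded_linear_intro[where K = 1])
  have T: "module_hom (*\<^sub>C) (*\<^sub>C) (T t)"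
    using clinear[of t] by (simp add: linear_iff_module_hom)
  show "T t (x + y) = T t x + T t y" for x y
    using T by (rule module_hom.add)
  show "T t (c *\<^sub>R x) = c *\<^sub>R T t x" for c x
    unfolding scaleR_scaleC using T by (rule module_hom.scale)
qed (simp add: isometry)

lemma add_apply: "T (s + t) f = T s (T t f)"
  by (simp add: add)

lemma commute: "T s (T t f) = T t (T s f)"
  by (metis add_apply add.commute)

text \<open>The group is commutative and each \<open>T t\<close> linear. This one identity yields
  invariance of the domain, commutation with \<open>D\<close> and differentiability of orbits at
  every time.\<close>

lemma quotient_shift: "(T h (T t f) - T t f) /\<^sub>R h = T t ((T h f - f) /\<^sub>R h)"
proof -
  interpret bounded_linear "T t" by (rule bounded_linear)
  show ?thesis by (simp add: scaleR diff commute)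
qed

lemma tendsto_quotient_shift:
  assumes "is_generator S D T" "f \<in> S"
  shows "((\<lambda>h. (T h (T t f) - T t f) /\<^sub>R h) \<longlongrightarrow> T t (D f)) (at 0)"
  unfolding quotient_shift using assms
  by (intro bounded_linear.tendsto[OF bounded_linear]) (auto simp: is_generator_def)

lemma generator_invariant:
  assumes "is_generator S D T" "f \<in> S"
  shows "T t f \<in> S" "D (T t f) = T t (D f)"
proof -
  show S: "T t f \<in> S"
    using tendsto_quotient_shift[OF assms] assms(1) by (auto simp: is_generator_def)
  then have "((\<lambda>h. (T h (T t f) - T t f) /\<^sub>R h) \<longlongrightarrow> D (T t f)) (at 0)"
    using assms(1) by (auto simp: is_generator_def)
  with tendsto_quotient_shift[OF assms] show "D (T t f) = T t (D f)"
    using tendsto_unique trivial_limit_at by blast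
qed

lemma generator_power_commute:
  assumes "is_generator S D T" "\<And>n. (D ^^ n) f \<in> S"
  shows "(D ^^ n) (T t f) = T t ((D ^^ n) f)"
  by (induction n) (simp_all add: generator_invariant(2)[OF assms(1)] assms(2))

lemma has_real_derivative_functional:
  assumes "is_generator S D T" "f \<in> S" and u: "bounded_linear u"
  shows "((\<lambda>t. u (T t f)) has_real_derivative u (T t (D f))) (at t)"
proof -
  interpret u: bounded_linear u by (rule u)
  have "((\<lambda>h. u ((T h (T t f) - T t f) /\<^sub>R h)) \<longlongrightarrow> u (T t (D f))) (at 0)"
    by (intro u.tendsto tendsto_quotient_shift[OF assms(1,2)])
  then show ?thesis
    by (simp add: DERIV_def u.scaleR u.diff divide_inverse mult.commute add_apply commute[of t])
qed

end

lemma smooth_domainD: "f \<in> smooth_domain S D \<Longrightarrow> (D ^^ n) f \<in> S"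
proof -
  assume "f \<in> smooth_domain S D"
  \<comment> \<open>It is the domain of the power \<open>n + 1\<close> that records membership of
    \<open>(D ^^ n) f\<close> in \<open>S\<close>.\<close>
  then have "f \<in> pow_domain S D (Suc n)" unfolding smooth_domain_def by blast
  then show ?thesis by simp
qed

section \<open>The Riesz-Boas formula\<close>

definition node_shift :: "nat \<Rightarrow> real" where
  "node_shift r = (if odd r then 1/2 else 0)"

text \<open>The sign in the series cancels the one inside the coefficient, which merges the odd and
  even cases into one formula.\<close>

lemma riesz_boas_term_eq:
  "riesz_boas_term T \<sigma> r f k =
     (deriv ^^ r) nsinc (node_shift r - of_int k) *\<^sub>R T (pi / \<sigma> * (of_int k - node_shift r)) f"
proof -
  have sgn: "(-1 :: real) powi (k + 1) * ((-1) powi (k + 1) * x) = x" for x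
    by (simp add: mult.assoc[symmetric] power_int_minus_one_mult_self)
  show ?thesis
  proof (cases "odd r")
    case True
    then have "2 * ((r + 1) div 2) - 1 = r" by presburger
    with True show ?thesis by (simp add: riesz_boas_term_def coeff_A_def sgn node_shift_def)
  next
    case False
    then have "2 * (r div 2) = r" by presburger
    with False show ?thesis by (simp add: riesz_boas_term_def coeff_B_def sgn node_shift_def)
  qed
qed

text \<open>The shift is chosen so that the phase \<open>pi * node_shift r + r * pi / 2\<close> is
  an integer multiple of \<open>pi\<close>.\<close>

lemma higher_deriv_sin_pi_node_shift:
  "(deriv ^^ r) (\<lambda>z::complex. sin (of_real pi * z)) (of_real (node_shift r)) = 0"
proof -
  have "sin (pi * node_shift r + r * pi / 2) = 0"
  proof (cases "odd r")
    case True
    then obtain m where "r = 2 * m + 1" by (elim oddE)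
    then have "pi * node_shift r + r * pi / 2 = real (m + 1) * pi"
      by (simp add: node_shift_def field_simps)
    then show ?thesis by (simp only: sin_npi)
  next
    case False
    then obtain m where "r = 2 * m" by (auto elim: evenE)
    then have "pi * node_shift r + r * pi / 2 = real m * pi"
      by (simp add: node_shift_def)
    then show ?thesis by (simp only: sin_npi)
  qed
  then have "sin (of_real (pi * node_shift r + r * pi / 2)) = (0 :: complex)"
    by (simp only: sin_of_real of_real_0)
  then show ?thesis by (simp add: higher_deriv_sin_pi)
qed

theorem theorem9p1:
  fixes T :: "real \<Rightarrow> 'a::complex_banach \<Rightarrow> 'a"
    and S :: "'a set" and D :: "'a \<Rightarrow> 'a"
    and \<sigma> :: real and r :: nat and f :: 'a
  assumes "isometry_group T"
    and "is_generator S D T"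
    and "\<sigma> > 0"
    and "r \<ge> 1"
    and "f \<in> bernstein_space S D \<sigma>"
  shows "riesz_boas_term T \<sigma> r f summable_on UNIV \<and>
         (D ^^ r) f = riesz_boas_operator T \<sigma> r f \<and>
         uniform_limit UNIV
           (\<lambda>K t. (\<sigma> / pi) ^ r *\<^sub>R (\<Sum>k\<in>K. riesz_boas_term T \<sigma> r (T t f) k))
           (\<lambda>t. (D ^^ r) (T t f))
           (finite_subsets_at_top UNIV)"
proof -
  interpret isometry_group T by fact
  have smooth: "(D ^^ n) f \<in> S" for n
    using assms(5) by (auto simp: bernstein_space_def intro: smooth_domainD)
  \<comment> \<open>The case \<open>n = 0\<close>, not part of the definition, is trivial.\<close>
  have bernstein: "norm ((D ^^ n) f) \<le> \<sigma> ^ n * norm f" for n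
    using assms(5) by (cases n) (auto simp: bernstein_space_def simp del: funpow.simps)
  define \<delta> where "\<delta> = node_shift r"
  define c where "c = (\<lambda>k::int. (deriv ^^ r) nsinc (\<delta> - of_int k))"
  define e where "e = (\<lambda>k::int. T (pi / \<sigma> * (of_int k - \<delta>)) f)"
  have terms: "riesz_boas_term T \<sigma> r f = (\<lambda>k. c k *\<^sub>R e k)"
    by (simp add: fun_eq_iff riesz_boas_term_eq c_def e_def \<delta>_def)
  have "(\<lambda>k. norm (c k) * norm f) summable_on UNIV"
    unfolding c_def \<delta>_def
    by (intro summable_on_cmult_left nsinc_higher_deriv_abs_summable higher_deriv_sin_pi_node_shift)
  then have summable: "(\<lambda>k. c k *\<^sub>R e k) summable_on UNIV"
    using abs_summable_summable[of "\<lambda>k. c k *\<^sub>R e k" UNIV] by (simp add: e_def isometry)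
  define V where "V = (\<Sum>\<^sub>\<infinity>k. c k *\<^sub>R e k)"
  have sum: "((\<lambda>k. c k *\<^sub>R e k) has_sum V) UNIV"
    using summable by (simp add: V_def)
  have eq: "(D ^^ r) f = (\<sigma> / pi) ^ r *\<^sub>R V"
  proof -
    \<comment> \<open>A real-linear functional norming the difference of the two sides; it passes
      through the series because the coefficients are real.\<close>
    obtain u :: "'a \<Rightarrow> real" where u: "linear u" "\<And>x. \<bar>u x\<bar> \<le> norm x"
      "\<bar>u ((D ^^ r) f - (\<sigma> / pi) ^ r *\<^sub>R V)\<bar> = norm ((D ^^ r) f - (\<sigma> / pi) ^ r *\<^sub>R V)"
      using norming_functional[of "(D ^^ r) f - (\<sigma> / pi) ^ r *\<^sub>R V"] by blast
    have bl: "bounded_linear u"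
      using u(1,2) by (intro bounded_linear_intro[where K = 1]) (auto simp: linear_add linear_scale)
    interpret u: bounded_linear u by (rule bl)
    \<comment> \<open>Time is rescaled so that the exponential type \<sigma> becomes
      \<open>pi\<close>; integers are the nodes and \<open>x = \<delta>\<close> is time 0.\<close>
    define G where "G = (\<lambda>n x. (pi / \<sigma>) ^ n * u (T (pi / \<sigma> * (x - \<delta>)) ((D ^^ n) f)))"
    have "((\<lambda>k. (deriv ^^ r) nsinc (\<delta> - of_int k) * G 0 (of_int k)) has_sum G r \<delta>) UNIV"
    proof (rule nsinc_derivative_interpolation)
      show "(G n has_real_derivative G (Suc n) x) (at x)" for n x
      proof -
        have "((\<lambda>x. u (T (pi / \<sigma> * (x - \<delta>)) ((D ^^ n) f))) has_real_derivative
            u (T (pi / \<sigma> * (x - \<delta>)) (D ((D ^^ n) f))) * (pi / \<sigma>)) (at x)"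
          by (rule DERIV_chain2[OF has_real_derivative_functional[OF assms(2) smooth bl]])
            (use assms(3) in \<open>auto intro!: derivative_eq_intros\<close>)
        then have "((\<lambda>x. (pi / \<sigma>) ^ n * u (T (pi / \<sigma> * (x - \<delta>)) ((D ^^ n) f))) has_real_derivative
            (pi / \<sigma>) ^ n * (u (T (pi / \<sigma> * (x - \<delta>)) (D ((D ^^ n) f))) * (pi / \<sigma>))) (at x)"
          by (rule DERIV_cmult)
        then show ?thesis by (simp add: G_def mult_ac)
      qed
      show "\<bar>G n x\<bar> \<le> norm f * pi ^ n" for n x
      proof -
        have "\<bar>u (T (pi / \<sigma> * (x - \<delta>)) ((D ^^ n) f))\<bar> \<le> \<sigma> ^ n * norm f"
          using u(2) bernstein isometry order_trans by metis
        then have "\<bar>G n x\<bar> \<le> (pi / \<sigma>) ^ n * (\<sigma> ^ n * norm f)"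
          using assms(3) unfolding G_def abs_mult by (intro mult_mono) auto
        also have "\<dots> = norm f * pi ^ n" using assms(3) by (simp add: power_divide)
        finally show ?thesis .
      qed
    qed (simp only: \<delta>_def higher_deriv_sin_pi_node_shift)
    then have "((\<lambda>k. u (c k *\<^sub>R e k)) has_sum (pi / \<sigma>) ^ r * u ((D ^^ r) f)) UNIV"
      by (simp add: G_def c_def e_def u.scaleR zero)
    moreover have "((\<lambda>k. u (c k *\<^sub>R e k)) has_sum u V) UNIV"
      using has_sum_bounded_linear[OF bl sum] by (simp add: o_def)
    ultimately have "u V = (pi / \<sigma>) ^ r * u ((D ^^ r) f)"
      using has_sum_unique by blast
    then have "u ((D ^^ r) f - (\<sigma> / pi) ^ r *\<^sub>R V) = 0"
      using assms(3) by (simp add: u.diff u.scaleR power_divide)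
    with u(3) show ?thesis by simp
  qed
  have lim: "((\<lambda>K. (\<sigma> / pi) ^ r *\<^sub>R (\<Sum>k\<in>K. c k *\<^sub>R e k)) \<longlongrightarrow> (D ^^ r) f) (finite_subsets_at_top UNIV)"
    unfolding eq using sum by (intro tendsto_intros) (simp add: has_sum_def)
  \<comment> \<open>The error for \<open>T t f\<close> is \<open>T t\<close> applied to the error
    for \<open>f\<close>; by isometry its norm does not depend on \<open>t\<close>, which gives
    uniformity.\<close>
  have dist_eq: "dist ((\<sigma> / pi) ^ r *\<^sub>R (\<Sum>k\<in>K. riesz_boas_term T \<sigma> r (T t f) k)) ((D ^^ r) (T t f))
      = dist ((\<sigma> / pi) ^ r *\<^sub>R (\<Sum>k\<in>K. c k *\<^sub>R e k)) ((D ^^ r) f)" for K t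
  proof -
    interpret Tt: bounded_linear "T t" by (rule bounded_linear)
    have "riesz_boas_term T \<sigma> r (T t f) k = T t (c k *\<^sub>R e k)" for k
      by (simp add: riesz_boas_term_eq c_def e_def \<delta>_def Tt.scaleR commute[of t])
    then have "(\<sigma> / pi) ^ r *\<^sub>R (\<Sum>k\<in>K. riesz_boas_term T \<sigma> r (T t f) k) - (D ^^ r) (T t f)
        = T t ((\<sigma> / pi) ^ r *\<^sub>R (\<Sum>k\<in>K. c k *\<^sub>R e k) - (D ^^ r) f)"
      by (simp add: Tt.diff Tt.scaleR Tt.sum generator_power_commute[OF assms(2) smooth])
    then show ?thesis by (simp add: dist_norm isometry)
  qed
  show ?thesis
  proof (intro conjI)
    show "riesz_boas_term T \<sigma> r f summable_on UNIV" using summable by (simp add: terms)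
    show "(D ^^ r) f = riesz_boas_operator T \<sigma> r f"
      using eq by (simp add: riesz_boas_operator_def terms V_def)
    show "uniform_limit UNIV
        (\<lambda>K t. (\<sigma> / pi) ^ r *\<^sub>R (\<Sum>k\<in>K. riesz_boas_term T \<sigma> r (T t f) k))
        (\<lambda>t. (D ^^ r) (T t f)) (finite_subsets_at_top UNIV)"
      unfolding uniform_limit_iff dist_eq using tendstoD[OF lim] by simp
  qed
qed

end
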